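(* Let $n\ge 1$ and let $v=(v_1,\ldots,v_n)\in\mathbb{R}^n$ be such that $v_1>v_2>\cdots>v_n$ and $v_i-v_{i+1}>n(v_{i+1}-v_n)$ for all $i\in\{1,\ldots,n-1\}$. Let $\sigma\in\mathfrak{S}_n$ be a permutation and let $R_\sigma$ be the region of the braid arrangement $\mathcal{A}_n$ labeled by $\sigma$. Then the projection dimension of $v$ on $R_\sigma$ equals the number of right-to-left minima of $\sigma$, that is, $\mathrm{pd}_v(R_\sigma)=\mathrm{RLmin}(\sigma)$.
   Context: The braid arrangement $\mathcal{A}_n$ in $\mathbb{R}^n$ is the collection of hyperplanes $H_{i,j}=\{x\in\mathbb{R}^n: x_i=x_j\}$, $1\le i<j\le n$. Regions are taken closed (closures of connected components of the complement of the hyperplanes). The region labeled by $\sigma=\sigma_1\cdots\sigma_n$ (one-line notation) is $R_\sigma=\{x: x_{\sigma_1}\ge x_{\sigma_2}\ge\cdots\ge x_{\sigma_n}\}$ (whose interior is given by the strict inequalities). For a region $R$ of a hyperplane arrangement in $\mathbb{R}^n$ and $v\in\mathbb{R}^n$, $\mathrm{proj}_v(R)$ is the unique point of $R$ at minimum Euclidean distance from $v$, and the projection dimension $\mathrm{pd}_v(R)$ is the dimension of the unique face of the polyhedron $R$ that contains $\mathrm{proj}_v(R)$ in its relative interior. An entry $\sigma_i$ is a right-to-left minimum of $\sigma$ if $\sigma_i<\sigma_j$ for all $j>i$; $\mathrm{RLmin}(\sigma)$ is the number of right-to-left minima of $\sigma$. *)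

theory Defs
  imports "HOL-Analysis.Analysis" "HOL-Combinatorics.Permutations"
begin

(* Euclidean n-space is real ^ 'n. Its coordinates are numbered 1, ..., n by a bijection
   e from {1..n} onto the index type 'n, so that v $ e i is the coordinate v_i and
   n = CARD('n). A permutation sigma of {1..n} has one-line notation
   sigma 1, ..., sigma n. *)

definition braid_arrangement :: "nat \<Rightarrow> (nat \<Rightarrow> 'n) \<Rightarrow> (real ^ 'n::finite) set set" where
  "braid_arrangement n e = {{x. x $ e i = x $ e j} | i j. 1 \<le> i \<and> i < j \<and> j \<le> n}"

definition regions :: "'a::euclidean_space set set \<Rightarrow> 'a set set" where
  "regions \<A> = closure ` components (- \<Union>\<A>)"

definition braid_region :: "nat \<Rightarrow> (nat \<Rightarrow> 'n) \<Rightarrow> (nat \<Rightarrow> nat) \<Rightarrow> (real ^ 'n::finite) set" where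
  "braid_region n e \<sigma> = {x. \<forall>i\<in>{1..<n}. x $ e (\<sigma> i) \<ge> x $ e (\<sigma> (i + 1))}"

(* For a nonempty closed convex R there is exactly one face F as described,
   and closest_point R v is the unique point of R nearest to v. *)
definition projection_dim :: "'a::euclidean_space \<Rightarrow> 'a set \<Rightarrow> int" where
  "projection_dim v R = aff_dim (THE F. F face_of R \<and> closest_point R v \<in> rel_interior F)"

definition RLmin :: "nat \<Rightarrow> (nat \<Rightarrow> nat) \<Rightarrow> nat" where
  "RLmin n \<sigma> = card {\<sigma> i | i. i \<in> {1..n} \<and> (\<forall>j\<in>{i<..n}. \<sigma> i < \<sigma> j)}"

lemma chain_less:
  fixes f :: "nat \<Rightarrow> real"
  assumes step: "\<And>i. i \<in> {1..<n} \<Longrightarrow> f (i + 1) < f i"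
    and "1 \<le> i" "i < j" "j \<le> n"
  shows "f j < f i"
  using assms(3,4)
proof (induction j)
  case (Suc j)
  have "f (Suc j) < f j"
    using step[of j] Suc.prems assms(2) by simp
  then show ?case
    using Suc by (cases "i = j") auto
qed simp

lemma braid_region_interior_component:
  fixes e :: "nat \<Rightarrow> 'n::finite"
  assumes e: "bij_betw e {1..n} UNIV" and s: "\<sigma> permutes {1..n}"
  defines "S \<equiv> {x :: real ^ 'n. \<forall>i\<in>{1..<n}. x $ e (\<sigma> i) > x $ e (\<sigma> (i + 1))}"
  shows "S \<in> components (- \<Union>(braid_arrangement n e))"
    and "closure S = braid_region n e \<sigma>"
proof -
  let ?C = "- \<Union>(braid_arrangement n e)"
  let ?w = "(\<chi> c. - real (inv \<sigma> (inv_into {1..n} e c))) :: real ^ 'n"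
  have sin: "\<sigma> i \<in> {1..n}" if "i \<in> {1..n}" for i
    using s that by (meson permutes_in_image)
  have w: "?w $ e (\<sigma> i) = - real i" if "i \<in> {1..n}" for i
    using sin[OF that] bij_betw_imp_inj_on[OF e] permutes_inverses(2)[OF s] by simp
  have wS: "?w \<in> S"
    unfolding S_def using w by fastforce
  have C: "x \<in> ?C \<longleftrightarrow> (\<forall>i j. 1 \<le> i \<and> i < j \<and> j \<le> n \<longrightarrow> x $ e i \<noteq> x $ e j)" for x
    unfolding braid_arrangement_def by blast
  have SC: "S \<subseteq> ?C"
  proof
    fix x assume x: "x \<in> S"
    have less: "x $ e (\<sigma> j) < x $ e (\<sigma> i)" if "1 \<le> i" "i < j" "j \<le> n" for i j
      using chain_less[of n "\<lambda>i. x $ e (\<sigma> i)" i j] x that unfolding S_def by auto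
    have "x $ e a \<noteq> x $ e b" if "1 \<le> a" "a < b" "b \<le> n" for a b
    proof -
      have "inv \<sigma> a \<in> {1..n}" "inv \<sigma> b \<in> {1..n}"
        using permutes_in_image[OF permutes_inv[OF s]] that by auto
      moreover have "\<sigma> (inv \<sigma> a) = a" "\<sigma> (inv \<sigma> b) = b"
        using permutes_inverses(1)[OF s] by auto
      ultimately show ?thesis
        using less[of "inv \<sigma> a" "inv \<sigma> b"] less[of "inv \<sigma> b" "inv \<sigma> a"] that
        by (metis atLeastAtMost_iff less_irrefl linorder_neqE_nat)
    qed
    then show "x \<in> ?C" unfolding C by blast
  qed
  have S_inner: "S = (\<Inter>i\<in>{1..<n}. {x. (axis (e (\<sigma> i)) 1 - axis (e (\<sigma> (i + 1))) 1) \<bullet> x > 0})"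
    unfolding S_def by (auto simp: inner_diff_left inner_axis' )
  have "convex S"
    unfolding S_inner by (intro convex_INT ballI convex_halfspace_gt)
  then have conn: "connected S" by (rule convex_connected)
  have max: "D = S" if D: "S \<subseteq> D" "D \<subseteq> ?C" "connected D" for D
  proof -
    have "y \<in> S" if y: "y \<in> D" for y
    proof (rule ccontr)
      assume "y \<notin> S"
      then obtain i where i: "i \<in> {1..<n}" "y $ e (\<sigma> i) \<le> y $ e (\<sigma> (i + 1))"
        unfolding S_def by force
      let ?a = "axis (e (\<sigma> i)) 1 - axis (e (\<sigma> (i + 1))) 1 :: real ^ 'n"
      have "?a \<bullet> y \<le> 0" "0 \<le> ?a \<bullet> ?w"
        using i w[of i] w[of "i + 1"] by (auto simp: inner_diff_left inner_axis')
      then obtain z where z: "z \<in> D" "?a \<bullet> z = 0"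
        using connected_ivt_hyperplane[OF D(3) y, of ?w ?a 0] wS D(1) by blast
      have "\<sigma> i \<noteq> \<sigma> (i + 1)"
        using permutes_inj[OF s] by (metis add_cancel_right_right injD one_neq_zero)
      moreover have "z $ e a \<noteq> z $ e b" if "a \<in> {1..n}" "b \<in> {1..n}" "a < b" for a b
        using z(1) D(2) C[of z] that by auto
      moreover have "\<sigma> i \<in> {1..n}" "\<sigma> (i + 1) \<in> {1..n}"
        using sin[of i] sin[of "i + 1"] i(1) by auto
      ultimately have "z $ e (\<sigma> i) \<noteq> z $ e (\<sigma> (i + 1))"
        by (metis linorder_neqE_nat)
      then show False
        using z(2) by (simp add: inner_diff_left inner_axis')
    qed
    then show ?thesis using D(1) by blast
  qed
  show "S \<in> components ?C"
    unfolding in_components_maximal using wS SC conn max by blast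
  have R_inner: "braid_region n e \<sigma> =
      (\<Inter>i\<in>{1..<n}. {x. (axis (e (\<sigma> i)) 1 - axis (e (\<sigma> (i + 1))) 1) \<bullet> x \<ge> 0})"
    unfolding braid_region_def by (auto simp: inner_diff_left inner_axis')
  have "closed (braid_region n e \<sigma>)"
    unfolding R_inner by (intro closed_INT ballI closed_halfspace_ge)
  moreover have "S \<subseteq> braid_region n e \<sigma>"
    unfolding S_def braid_region_def by (auto intro: less_imp_le)
  ultimately have 1: "closure S \<subseteq> braid_region n e \<sigma>"
    by (simp add: closure_minimal)
  have 2: "x \<in> closure S" if x: "x \<in> braid_region n e \<sigma>" for x
  proof -
    have "x + inverse (real (Suc m)) *\<^sub>R ?w \<in> S" for m
    proof -
      have "x $ e (\<sigma> (i + 1)) + inverse (real (Suc m)) * ?w $ e (\<sigma> (i + 1))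
          < x $ e (\<sigma> i) + inverse (real (Suc m)) * ?w $ e (\<sigma> i)" if i: "i \<in> {1..<n}" for i
      proof (rule add_le_less_mono)
        show "x $ e (\<sigma> (i + 1)) \<le> x $ e (\<sigma> i)"
          using x i unfolding braid_region_def by blast
        have "?w $ e (\<sigma> (i + 1)) < ?w $ e (\<sigma> i)"
          using wS i unfolding S_def by blast
        then show "inverse (real (Suc m)) * ?w $ e (\<sigma> (i + 1))
            < inverse (real (Suc m)) * ?w $ e (\<sigma> i)"
          by (intro mult_strict_left_mono) auto
      qed
      then show ?thesis unfolding S_def
        by (simp del: vec_lambda_beta)
    qed
    moreover have "(\<lambda>m. x + inverse (real (Suc m)) *\<^sub>R ?w) \<longlonglongrightarrow> x + 0 *\<^sub>R ?w"
      by (intro tendsto_intros LIMSEQ_inverse_real_of_nat)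
    then have "(\<lambda>m. x + inverse (real (Suc m)) *\<^sub>R ?w) \<longlonglongrightarrow> x"
      by simp
    ultimately show ?thesis
      unfolding closure_sequential
      by (intro exI[of _ "\<lambda>m. x + inverse (real (Suc m)) *\<^sub>R ?w"] conjI allI)
  qed
  show "closure S = braid_region n e \<sigma>"
    using 1 2 by blast
qed

lemma braid_region_in_regions:
  assumes "bij_betw e {1..n} UNIV" and "\<sigma> permutes {1..n}"
  shows "braid_region n e \<sigma> \<in> regions (braid_arrangement n e)"
  unfolding regions_def
  by (rule image_eqI[where f = closure, OF braid_region_interior_component(2)[OF assms, symmetric]
        braid_region_interior_component(1)[OF assms]])

end

theory Submission
  imports Defs
begin

text \<open>Call two positions \<open>i\<close> equivalent if the suffixes of \<open>\<sigma>\<close> starting there have the same minimum.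
  The classes are the intervals that end at the right-to-left minima of \<open>\<sigma>\<close>, and within its class
  a right-to-left minimum carries the largest value of \<open>v\<close>. By the growth condition this value is so
  dominant that the mean of \<open>v\<close> over the class exceeds all other values of \<open>v\<close> in this and in the
  later classes. Hence averaging \<open>v\<close> over the classes gives a point \<open>y\<close> of the region which is
  strictly decreasing from class to class, and \<open>v - y\<close> is negative except at the ends of
  the classes. So \<open>v - y\<close> is nonpositive on the region, which makes \<open>y\<close> the projection of \<open>v\<close>, and
  it vanishes exactly on the points of the region that are constant on the classes. These form the
  face with \<open>y\<close> in its relative interior; its dimension is the number of classes.\<close>

section \<open>Vectors constant on the fibres of a map, and a criterion for the projection
  dimension\<close>

lemma dim_constant_on_fibres:
  fixes k :: "'n::finite \<Rightarrow> 'b"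
  shows "dim {x :: real ^ 'n. \<forall>c d. k c = k d \<longrightarrow> x $ c = x $ d} = card (range k)"
proof -
  \<comment> \<open>The indicator vectors of the fibres form a basis: disjoint supports make them
    orthogonal, hence independent.\<close>
  define b :: "'b \<Rightarrow> real ^ 'n" where "b l = (\<chi> c. if k c = l then 1 else 0)" for l
  let ?L = "{x :: real ^ 'n. \<forall>c d. k c = k d \<longrightarrow> x $ c = x $ d}"
  have b_nth: "b l $ c = (if k c = l then 1 else 0)" for l c
    by (simp add: b_def)
  have inj: "inj_on b (range k)"
  proof (rule inj_onI)
    fix l l' assume "l \<in> range k" "l' \<in> range k" and eq: "b l = b l'"
    then obtain c where "k c = l" by auto
    with arg_cong[OF eq, of "\<lambda>x. x $ c"] show "l = l'"
      by (simp add: b_nth split: if_splits)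
  qed
  have nonzero: "b l \<noteq> 0" if "l \<in> range k" for l
    using that by (auto simp: vec_eq_iff b_nth)
  have orth: "pairwise orthogonal (b ` range k)"
    by (auto simp: pairwise_def orthogonal_def inner_vec_def b_nth intro!: sum.neutral)
  have indep: "independent (b ` range k)"
    using pairwise_orthogonal_independent[OF orth] nonzero by (metis imageE)
  have "?L \<subseteq> span (b ` range k)"
  proof
    fix x assume x: "x \<in> ?L"
    define r where "r l = (SOME c. k c = l)" for l
    have r: "k (r (k c)) = k c" for c
      unfolding r_def by (rule someI) simp
    have "x = (\<Sum>l\<in>range k. (x $ r l) *\<^sub>R b l)"
    proof (subst vec_eq_iff, intro allI)
      fix c
      have "(\<Sum>l\<in>range k. (x $ r l) *\<^sub>R b l) $ c = (\<Sum>l\<in>range k. if k c = l then x $ r l else 0)"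
        by (simp add: b_nth if_distrib cong: if_cong)
      also have "\<dots> = x $ r (k c)"
        by (simp add: sum.delta)
      also have "\<dots> = x $ c"
        using x r by blast
      finally show "x $ c = (\<Sum>l\<in>range k. (x $ r l) *\<^sub>R b l) $ c" by simp
    qed
    also have "\<dots> \<in> span (b ` range k)"
      by (intro span_sum span_mul span_base) auto
    finally show "x \<in> span (b ` range k)" .
  qed
  moreover have "b ` range k \<subseteq> ?L"
    by (auto simp: b_nth)
  ultimately have "dim ?L = card (b ` range k)"
    using indep by (intro dim_unique) auto
  then show ?thesis
    using inj by (simp add: card_image)
qed

lemma subspace_constant_on_fibres:
  "subspace {x :: real ^ 'n. \<forall>c d. k c = k d \<longrightarrow> x $ c = x $ d}"
  (is "subspace ?L")
proof (rule subspaceI)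
  show "x + y \<in> ?L" if "x \<in> ?L" "y \<in> ?L" for x y
    using that unfolding mem_Collect_eq vector_add_component by metis
  show "a *\<^sub>R x \<in> ?L" if "x \<in> ?L" for a x
    using that unfolding mem_Collect_eq vector_scaleR_component by metis
qed simp

text \<open>This is the orthogonal projection of \<open>v\<close> onto the vectors constant on the
  fibres of \<open>k\<close>.\<close>

definition fibre_mean :: "('n::finite \<Rightarrow> 'b) \<Rightarrow> real ^ 'n \<Rightarrow> real ^ 'n" where
  "fibre_mean k v = (\<chi> c. (\<Sum>d | k d = k c. v $ d) / card {d. k d = k c})"

text \<open>On each fibre the deviations from the mean sum to zero, and \<open>x\<close> contributes
  only a constant factor.\<close>

lemma inner_minus_fibre_mean:
  fixes x v :: "real ^ 'n::finite"
  assumes x: "\<And>c d. k c = k d \<Longrightarrow> x $ c = x $ d"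
  shows "(v - fibre_mean k v) \<bullet> x = 0"
proof -
  have "(v - fibre_mean k v) \<bullet> x = (\<Sum>c\<in>UNIV. (v - fibre_mean k v) $ c * x $ c)"
    by (simp add: inner_vec_def)
  also have "\<dots> = (\<Sum>l\<in>range k. \<Sum>c | k c = l. (v - fibre_mean k v) $ c * x $ c)"
    using sum.image_gen[of UNIV "\<lambda>c. (v - fibre_mean k v) $ c * x $ c" k] by simp
  also have "\<dots> = 0"
  proof (rule sum.neutral, rule ballI)
    fix l assume "l \<in> range k"
    then obtain a where a: "l = k a" by auto
    then have ne: "real (card {d. k d = l}) \<noteq> 0"
      by (auto simp: card_eq_0_iff)
    have "(\<Sum>c | k c = l. (v - fibre_mean k v) $ c * x $ c)
        = (\<Sum>c | k c = l. (v $ c - (\<Sum>d | k d = l. v $ d) / card {d. k d = l}) * x $ a)"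
      by (intro sum.cong) (auto simp: fibre_mean_def a intro: x)
    also have "\<dots> = 0"
      using ne by (simp add: sum_subtractf flip: sum_distrib_right)
    finally show "(\<Sum>c | k c = l. (v - fibre_mean k v) $ c * x $ c) = 0" .
  qed
  finally show ?thesis .
qed

text \<open>The inequality makes \<open>y\<close> the nearest point and cuts out a face by a
  supporting hyperplane. This face lies in \<open>L\<close> and contains a neighbourhood of
  \<open>y\<close> in \<open>L\<close>, so it has the dimension of \<open>L\<close> and
  \<open>y\<close> is relatively interior.\<close>

lemma projection_dim_eqI:
  fixes v y :: "'a::euclidean_space"
  assumes R: "closed R" "convex R" and y: "y \<in> R" "(v - y) \<bullet> y = 0"
    and le: "\<And>x. x \<in> R \<Longrightarrow> (v - y) \<bullet> x \<le> 0"
    and L: "subspace L" and sub: "\<And>x. x \<in> R \<Longrightarrow> (v - y) \<bullet> x = 0 \<Longrightarrow> x \<in> L"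
    and U: "open U" "y \<in> U" "U \<inter> L \<subseteq> {x \<in> R. (v - y) \<bullet> x = 0}"
  shows "projection_dim v R = int (dim L)"
proof -
  define F where "F = R \<inter> {x. (v - y) \<bullet> x = 0}"
  have face: "F face_of R"
    unfolding F_def by (rule face_of_Int_supporting_hyperplane_le[OF R(2) le])
  have yL: "y \<in> L"
    using sub y by blast
  have closest: "closest_point R v = y"
  proof (rule sym, rule closest_point_unique[OF R(2,1) y(1)], rule ballI)
    fix z assume z: "z \<in> R"
    have "dist v z ^ 2 = dist v y ^ 2 + dist y z ^ 2 - 2 * ((v - y) \<bullet> (z - y))"
      by (simp add: dist_norm power2_norm_eq_inner inner_diff_left inner_diff_right inner_commute)
    moreover have "(v - y) \<bullet> (z - y) \<le> 0"
      using le[OF z] y(2) by (simp add: inner_diff_right[of "v - y"])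
    ultimately have "dist v y ^ 2 \<le> dist v z ^ 2"
      using zero_le_power2[of "dist y z"] by linarith
    then show "dist v y \<le> dist v z"
      by (rule power2_le_imp_le) simp
  qed
  have UF: "U \<inter> L \<subseteq> F" and FL: "F \<subseteq> L"
    using U(3) sub by (auto simp: F_def)
  \<comment> \<open>A nonempty relatively open part of \<open>L\<close> already spans
    \<open>L\<close>, and \<open>F\<close> is sandwiched between the two.\<close>
  have "affine hull (L \<inter> U) = affine hull L"
    using U yL L by (intro affine_hull_affine_Int_open) (auto simp: subspace_imp_affine)
  then have hull: "affine hull F = L"
    using hull_mono[of "L \<inter> U" F affine] hull_mono[OF FL, of affine] UF L
    by (auto simp: Int_commute hull_same subspace_imp_affine)
  have yF: "y \<in> rel_interior F"
    using U(1,2) UF yL by (auto simp: mem_rel_interior hull)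
  have "(THE F. F face_of R \<and> closest_point R v \<in> rel_interior F) = F"
  proof (rule the_equality)
    show "F face_of R \<and> closest_point R v \<in> rel_interior F"
      using face yF closest by simp
  next
    \<comment> \<open>Two faces whose relative interiors meet coincide.\<close>
    fix G assume "G face_of R \<and> closest_point R v \<in> rel_interior G"
    then show "G = F"
      using face yF closest face_of_eq[of G R F] by auto
  qed
  then have "projection_dim v R = aff_dim F"
    by (simp add: projection_dim_def)
  also have "\<dots> = aff_dim L"
    using hull by (metis aff_dim_affine_hull)
  finally show ?thesis
    using L by (simp add: aff_dim_subspace)
qed

section \<open>Suffix minima and right-to-left minima\<close>

definition suffix_min :: "nat \<Rightarrow> (nat \<Rightarrow> nat) \<Rightarrow> nat \<Rightarrow> nat" where
  "suffix_min n \<sigma> i = Min (\<sigma> ` {i..n})"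

lemma suffix_min_le: "i \<le> j \<Longrightarrow> j \<le> n \<Longrightarrow> suffix_min n \<sigma> i \<le> \<sigma> j"
  by (simp add: suffix_min_def)

lemma suffix_min_mono: "i \<le> j \<Longrightarrow> j \<le> n \<Longrightarrow> suffix_min n \<sigma> i \<le> suffix_min n \<sigma> j"
  unfolding suffix_min_def by (intro Min_antimono) auto

text \<open>The last equation says that the attaining position belongs to the class it labels; it
  follows by squeezing with monotonicity.\<close>

lemma suffix_min_attained:
  assumes "i \<le> n"
  obtains j where "i \<le> j" "j \<le> n" "suffix_min n \<sigma> i = \<sigma> j" "suffix_min n \<sigma> j = \<sigma> j"
proof -
  have "suffix_min n \<sigma> i \<in> \<sigma> ` {i..n}"
    unfolding suffix_min_def using assms by (intro Min_in) auto
  then obtain j where j: "i \<le> j" "j \<le> n" "suffix_min n \<sigma> i = \<sigma> j" by auto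
  with suffix_min_mono[of i j n \<sigma>] suffix_min_le[of j j n \<sigma>] that show thesis
    by simp
qed

text \<open>A position attaining a suffix minimum is no larger than the later entries, and
  injectivity makes this strict.\<close>

lemma RLmin_eq_card_suffix_min:
  assumes "inj_on \<sigma> {1..n}"
  shows "RLmin n \<sigma> = card (suffix_min n \<sigma> ` {1..n})"
proof -
  have "{\<sigma> i | i. i \<in> {1..n} \<and> (\<forall>j\<in>{i<..n}. \<sigma> i < \<sigma> j)} = suffix_min n \<sigma> ` {1..n}"
  proof (intro equalityI subsetI)
    fix l assume "l \<in> {\<sigma> i | i. i \<in> {1..n} \<and> (\<forall>j\<in>{i<..n}. \<sigma> i < \<sigma> j)}"
    then obtain i where i: "l = \<sigma> i" "i \<in> {1..n}" "\<forall>j\<in>{i<..n}. \<sigma> i < \<sigma> j" by auto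
    then have "suffix_min n \<sigma> i = l"
      unfolding suffix_min_def by (intro Min_eqI) (auto simp: le_less)
    then show "l \<in> suffix_min n \<sigma> ` {1..n}" using i(2) by blast
  next
    fix l assume "l \<in> suffix_min n \<sigma> ` {1..n}"
    then obtain i where i: "i \<in> {1..n}" "l = suffix_min n \<sigma> i" by auto
    then obtain j where j: "i \<le> j" "j \<le> n" "l = \<sigma> j" "suffix_min n \<sigma> j = \<sigma> j"
      using suffix_min_attained[of i n \<sigma>] by auto
    have "\<sigma> j < \<sigma> a" if "a \<in> {j<..n}" for a
    proof -
      have "\<sigma> j \<le> \<sigma> a" using suffix_min_le[of j a n \<sigma>] j that by simp
      moreover have "\<sigma> j \<noteq> \<sigma> a" using inj_onD[OF assms, of j a] that i j by auto
      ultimately show ?thesis by simp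
    qed
    then show "l \<in> {\<sigma> i | i. i \<in> {1..n} \<and> (\<forall>j\<in>{i<..n}. \<sigma> i < \<sigma> j)}"
      using i j by (intro CollectI exI[of _ j]) auto
  qed
  then show ?thesis by (simp add: RLmin_def)
qed

text \<open>Measured from the lower bound \<open>z\<close>, the single term \<open>f a\<close>
  already exceeds \<open>n\<close> times the level \<open>t\<close>, and the mean divides by at most
  \<open>n\<close>.\<close>

lemma mean_gt_if_dominant:
  fixes f :: "'a \<Rightarrow> real"
  assumes "finite A" "a \<in> A" "card A \<le> n"
    and ge: "\<And>d. d \<in> A \<Longrightarrow> f d \<ge> z" and "t \<ge> z"
    and gap: "f a - t > real n * (t - z)"
  shows "(\<Sum>d\<in>A. f d) / card A > t"
proof -
  have pos: "0 < card A" using assms(1,2) by (auto simp: card_gt_0_iff)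
  have "real (card A) * (t - z) \<le> real n * (t - z)"
    using assms(3,5) by (intro mult_right_mono) auto
  also have "\<dots> < f a - t" by (rule gap)
  also have "\<dots> \<le> f a - z" using \<open>t \<ge> z\<close> by simp
  also have "\<dots> \<le> (\<Sum>d\<in>A. f d - z)"
    using assms(1,2) ge by (intro member_le_sum) auto
  also have "\<dots> = (\<Sum>d\<in>A. f d) - card A * z"
    by (simp add: sum_subtractf)
  finally show ?thesis
    using pos by (simp add: field_simps)
qed

section \<open>Closedness, convexity and monotonicity of braid regions\<close>

lemma closed_braid_region: "closed (braid_region n e \<sigma>)"
  unfolding braid_region_def Ball_def imp_conv_disj
  by (intro closed_Collect_all closed_Collect_disj closed_Collect_const closed_Collect_le
      continuous_intros)

lemma convex_braid_region: "convex (braid_region n e \<sigma>)"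
  by (auto simp: convex_def braid_region_def intro!: add_mono mult_left_mono)

lemma braid_region_antimono:
  assumes "x \<in> braid_region n e \<sigma>" "1 \<le> i" "i \<le> j" "j \<le> n"
  shows "x $ e (\<sigma> j) \<le> x $ e (\<sigma> i)"
  using assms(3,4)
proof (induction j rule: dec_induct)
  case (step j)
  then have "x $ e (\<sigma> (j + 1)) \<le> x $ e (\<sigma> j)"
    using assms(1,2) by (simp add: braid_region_def)
  with step show ?case by simp
qed simp

section \<open>Projection onto a braid region under the growth condition\<close>

theorem theorem3p3:
  fixes n :: nat and e :: "nat \<Rightarrow> 'n::finite" and v :: "real ^ 'n" and \<sigma> :: "nat \<Rightarrow> nat"
  assumes "n \<ge> 1"
    and "bij_betw e {1..n} (UNIV :: 'n set)"
    and "\<forall>i\<in>{1..<n}. v $ e i > v $ e (i + 1)"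
    and "\<forall>i\<in>{1..<n}. v $ e i - v $ e (i + 1) > real n * (v $ e (i + 1) - v $ e n)"
    and "\<sigma> permutes {1..n}"
  shows "projection_dim v (braid_region n e \<sigma>) = int (RLmin n \<sigma>)"
proof -
  let ?R = "braid_region n e \<sigma>"
  let ?m = "suffix_min n \<sigma>"
  \<comment> \<open>Classes are transferred from positions to coordinates: \<open>pos c\<close> is
    the place of \<open>c\<close> in the order given by \<sigma>, and \<open>e (k c)\<close> is the
    coordinate of the right-to-left minimum ending the class of \<open>c\<close>.\<close>
  define pos where "pos = inv_into {1..n} (e \<circ> \<sigma>)"
  define k where "k c = ?m (pos c)" for c
  define y where "y = fibre_mean k v"
  define L where "L = {x :: real ^ 'n. \<forall>c d. k c = k d \<longrightarrow> x $ c = x $ d}"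
  \<comment> \<open>Strict descent is required only across class boundaries; inside a class,
    \<open>L\<close> forces equality.\<close>
  define U where "U = {x :: real ^ 'n. \<forall>i\<in>{i\<in>{1..<n}. ?m i < ?m (i + 1)}.
    x $ e (\<sigma> (i + 1)) < x $ e (\<sigma> i)}"

  have bij: "bij_betw (e \<circ> \<sigma>) {1..n} UNIV"
    using bij_betw_trans[OF permutes_imp_bij[OF assms(5)] assms(2)] .
  have \<sigma>: "\<sigma> i \<in> {1..n}" if "i \<in> {1..n}" for i
    using permutes_in_image[OF assms(5)] that by blast
  have pos: "pos c \<in> {1..n}" "e (\<sigma> (pos c)) = c" for c
    using bij inv_into_into[of c "e \<circ> \<sigma>" "{1..n}"] f_inv_into_f[of c "e \<circ> \<sigma>" "{1..n}"]
    by (auto simp: pos_def bij_betw_def)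
  have pos_e: "pos (e (\<sigma> i)) = i" if "i \<in> {1..n}" for i
    using inv_into_f_f[OF bij_betw_imp_inj_on[OF bij] that] by (simp add: pos_def)
  have k_e: "k (e (\<sigma> i)) = ?m i" if "i \<in> {1..n}" for i
    using pos_e[OF that] by (simp add: k_def)
  have k_le: "k c \<le> \<sigma> (pos c)" for c
    using pos(1)[of c] by (simp add: k_def suffix_min_le)
  have k_attained: "\<exists>j. pos c \<le> j \<and> j \<le> n \<and> k c = \<sigma> j \<and> k (e (k c)) = k c" for c
  proof -
    obtain j where "pos c \<le> j" "j \<le> n" "?m (pos c) = \<sigma> j" "?m j = \<sigma> j"
      using suffix_min_attained[of "pos c" n \<sigma>] pos(1)[of c] by auto
    then show ?thesis
      using pos(1)[of c] k_e[of j] by (intro exI[of _ j]) (simp add: k_def)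
  qed
  have k_idem: "k (e (k c)) = k c" for c
    using k_attained[of c] by blast
  have k_in: "k c \<in> {1..n}" for c
    using k_attained[of c] \<sigma> pos(1)[of c] by fastforce

  have v_le: "v $ e j \<le> v $ e i" if "1 \<le> i" "i \<le> j" "j \<le> n" for i j
    using chain_less[of n "\<lambda>i. v $ e i" i j] assms(3) that by (cases "i = j") auto
  have v_end: "v $ e n \<le> v $ c" for c
    using v_le[of "\<sigma> (pos c)" n] \<sigma>[OF pos(1)[of c]] pos(2)[of c] by simp

  \<comment> \<open>The growth condition at index \<open>k c\<close> makes \<open>e (k c)\<close>
    dominant in its class. All other members, and all later classes, have indices at least
    \<open>k c + 1\<close>.\<close>
  have mean_gt: "v $ e (k c + 1) < y $ c" if "k c < n" for c
  proof -
    have "card {d. k d = k c} \<le> n"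
      using card_mono[of UNIV "{d. k d = k c}"] bij_betw_same_card[OF assms(2)] by simp
    moreover have "v $ e (k c) - v $ e (k c + 1) > real n * (v $ e (k c + 1) - v $ e n)"
      using assms(4) that k_in[of c] by auto
    ultimately show ?thesis
      using k_idem[of c] v_end mean_gt_if_dominant[of "{d. k d = k c}" "e (k c)" n "v $ e n" "\<lambda>d. v $ d"
          "v $ e (k c + 1)"]
      by (simp add: y_def fibre_mean_def)
  qed
  have mean_le: "y $ c \<le> v $ e (k c)" for c
  proof -
    have "v $ d \<le> v $ e (k c)" if "k d = k c" for d
      using v_le[of "k c" "\<sigma> (pos d)"] k_in[of c] k_le[of d] \<sigma>[OF pos(1)[of d]] pos(2)[of d] that
      by simp
    then have "(\<Sum>d | k d = k c. v $ d) \<le> of_nat (card {d. k d = k c}) * v $ e (k c)"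
      by (intro sum_bounded_above) auto
    moreover have "0 < card {d. k d = k c}"
      by (auto simp: card_gt_0_iff)
    ultimately show ?thesis
      by (simp add: y_def fibre_mean_def field_simps)
  qed
  have yL: "y \<in> L"
    by (auto simp: L_def y_def fibre_mean_def)
  have yU: "y \<in> U"
    unfolding U_def
  proof safe
    fix i assume i: "i \<in> {1..<n}" "?m i < ?m (i + 1)"
    let ?c = "e (\<sigma> i)" and ?d = "e (\<sigma> (i + 1))"
    \<comment> \<open>The later mean is at most the largest value in its class, which the earlier
      mean exceeds.\<close>
    have k: "k ?c < k ?d"
      using i k_e[of i] k_e[of "i + 1"] by simp
    have "y $ ?d \<le> v $ e (k ?d)" by (rule mean_le)
    also have "\<dots> \<le> v $ e (k ?c + 1)"
      using v_le[of "k ?c + 1" "k ?d"] k k_in[of ?d] by simp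
    also have "\<dots> < y $ ?c"
      using mean_gt[of ?c] k k_in[of ?d] by simp
    finally show "y $ ?d < y $ ?c" .
  qed
  have ULR: "U \<inter> L \<subseteq> ?R"
  proof
    fix x assume x: "x \<in> U \<inter> L"
    have "x $ e (\<sigma> (i + 1)) \<le> x $ e (\<sigma> i)" if i: "i \<in> {1..<n}" for i
    proof (cases "?m i = ?m (i + 1)")
      case True
      then have "k (e (\<sigma> i)) = k (e (\<sigma> (i + 1)))" using i k_e[of i] k_e[of "i + 1"] by simp
      then have "x $ e (\<sigma> i) = x $ e (\<sigma> (i + 1))" using x unfolding L_def by blast
      then show ?thesis by simp
    next
      case False
      then have "?m i < ?m (i + 1)" using suffix_min_mono[of i "i + 1" n \<sigma>] i by simp
      then show ?thesis using x i by (auto simp: U_def intro: less_imp_le)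
    qed
    then show "x \<in> ?R" by (simp add: braid_region_def)
  qed
  have perp: "(v - y) \<bullet> x = 0" if "x \<in> L" for x
    unfolding y_def using that by (intro inner_minus_fibre_mean) (unfold L_def, blast)

  have inner: "(v - y) \<bullet> x = (\<Sum>c\<in>UNIV. (v - y) $ c * (x $ c - x $ e (k c)))" for x
  proof -
    \<comment> \<open>Subtracting from \<open>x\<close> its values at the class ends costs nothing,
      since \<open>z\<close> is orthogonal to \<open>v - y\<close>, and gives every summand a
      definite sign on the region.\<close>
    define z :: "real ^ 'n" where "z = (\<chi> c. x $ e (k c))"
    have "(v - y) \<bullet> z = 0" by (rule perp) (simp add: L_def z_def)
    then have "(v - y) \<bullet> x = (v - y) \<bullet> (x - z)" by (simp add: inner_diff_right[of "v - y"])
    then show ?thesis by (simp add: inner_vec_def z_def)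
  qed
  have neg: "(v - y) $ c < 0" if "c \<noteq> e (k c)" for c
  proof -
    have "k c \<noteq> \<sigma> (pos c)" using that pos(2)[of c] by metis
    then have lt: "k c < \<sigma> (pos c)" using k_le[of c] by simp
    then have "v $ c \<le> v $ e (k c + 1)"
      using v_le[of "k c + 1" "\<sigma> (pos c)"] \<sigma>[OF pos(1)[of c]] pos(2)[of c] by simp
    also have "\<dots> < y $ c"
      using mean_gt[of c] lt \<sigma>[OF pos(1)[of c]] by simp
    finally show ?thesis by simp
  qed
  \<comment> \<open>The minimum ending the class of \<open>c\<close> stands at or after
    \<open>c\<close>, and coordinates decrease weakly along \<sigma>.\<close>
  have diff: "0 \<le> x $ c - x $ e (k c)" if "x \<in> ?R" for x c
  proof -
    obtain j where "pos c \<le> j" "j \<le> n" "k c = \<sigma> j" using k_attained[of c] by blast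
    then show ?thesis
      using braid_region_antimono[OF that, of "pos c" j] pos[of c] by simp
  qed
  have term_le: "(v - y) $ c * (x $ c - x $ e (k c)) \<le> 0" if "x \<in> ?R" for x c
    using diff[OF that, of c] neg[of c]
    by (cases "c = e (k c)") (auto intro!: mult_nonpos_nonneg simp del: vector_minus_component)

  have "projection_dim v ?R = int (dim L)"
  proof (rule projection_dim_eqI)
    show "closed ?R" "convex ?R" by (fact closed_braid_region convex_braid_region)+
    show "y \<in> ?R" using yU yL ULR by blast
    show "(v - y) \<bullet> y = 0" by (rule perp[OF yL])
    show "(v - y) \<bullet> x \<le> 0" if "x \<in> ?R" for x
      unfolding inner using term_le[OF that] by (intro sum_nonpos) auto
    show "subspace L" unfolding L_def by (rule subspace_constant_on_fibres)
    show "x \<in> L" if x: "x \<in> ?R" "(v - y) \<bullet> x = 0" for x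
    proof -
      \<comment> \<open>A vanishing sum of nonpositive terms has only zero terms; away from the
        class ends the factor \<open>(v - y) $ c\<close> is strictly negative, so the other factor
        vanishes.\<close>
      have "(v - y) $ c * (x $ c - x $ e (k c)) = 0" for c
        using x(2) sum_nonneg_eq_0_iff[of UNIV "\<lambda>c. - ((v - y) $ c * (x $ c - x $ e (k c)))"]
          term_le[OF x(1)] unfolding inner by (simp add: sum_negf del: vector_minus_component)
      then have *: "x $ c = x $ e (k c)" for c
        using neg[of c] by (metis eq_iff_diff_eq_0 less_irrefl mult_eq_0_iff)
      show ?thesis unfolding L_def mem_Collect_eq using * by metis
    qed
    show "open U"
    proof -
      have "U = (\<Inter>i\<in>{i\<in>{1..<n}. ?m i < ?m (i + 1)}. {x. x $ e (\<sigma> (i + 1)) < x $ e (\<sigma> i)})"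
        by (auto simp: U_def)
      also have "open \<dots>"
        by (intro open_INT ballI open_Collect_less continuous_intros) auto
      finally show ?thesis .
    qed
    show "y \<in> U" by (rule yU)
    show "U \<inter> L \<subseteq> {x \<in> ?R. (v - y) \<bullet> x = 0}" using ULR perp by blast
  qed
  also have "dim L = card (range k)"
    unfolding L_def by (rule dim_constant_on_fibres)
  also have "range k = ?m ` {1..n}"
  proof (intro equalityI subsetI)
    fix l assume "l \<in> ?m ` {1..n}"
    then obtain i where "i \<in> {1..n}" "l = ?m i" by blast
    then show "l \<in> range k" using k_e[of i] by (intro range_eqI[of _ _ "e (\<sigma> i)"]) simp
  qed (use pos(1) in \<open>auto simp: k_def\<close>)
  also have "card (?m ` {1..n}) = RLmin n \<sigma>"
    using RLmin_eq_card_suffix_min[OF permutes_inj_on[OF assms(5)]] by simp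
  finally show ?thesis .
qed

end
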